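(* For all integers $a,b\ge 0$, $$H(a,b)=2\sum_{k=1}^{a+b+1}(-1)^k\, c_{a,b}^{k}\,\zeta(2k+1)\,H(a+b+1-k),$$ where $$c_{a,b}^{k}=\binom{2k}{2a+2}-\left(1-\frac{1}{2^{2k}}\right)\binom{2k}{2b+1}.$$
   Context: For positive integers $k_1,\dots,k_r$ with $k_r>1$, the multiple zeta value is $$\zeta(k_1,\dots,k_r)=\sum_{1\le n_1<n_2<\cdots<n_r}\frac{1}{n_1^{k_1}n_2^{k_2}\cdots n_r^{k_r}}$$ (sum over integers), so that in depth $1$ it is the Riemann zeta value. For integers $n,a,b\ge 0$ put $$H(n)=\zeta(\underbrace{2,\dots,2}_{n}),\qquad H(a,b)=\zeta(\underbrace{2,\dots,2}_{a},3,\underbrace{2,\dots,2}_{b}),$$ with $H(0)=1$. Binomial coefficients $\binom{m}{j}$ with $j>m\ge 0$ are $0$. *)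

theory Defs
  imports "HOL-Analysis.Analysis"
begin

text \<open>The summation variables \<open>n\<^sub>1 < n\<^sub>2 < \<dots> < n\<^sub>r\<close> of a multiple zeta value of depth \<open>r\<close>.\<close>

definition mzv_indices :: "nat \<Rightarrow> nat list set" where
  "mzv_indices r = {ns. length ns = r \<and> sorted_wrt (<) ns \<and> (\<forall>n\<in>set ns. 1 \<le> n)}"

text \<open>
  The largest summation variable carries the last exponent, so the series converges when all
  entries of the list are positive and the last one exceeds \<open>1\<close>; elsewhere the value of the
  definition has no meaning, except that the empty list yields \<open>1\<close>. In depth \<open>1\<close>,
  \<open>mzv [k]\<close> is the Riemann zeta value at \<open>k\<close>.
\<close>

definition mzv :: "nat list \<Rightarrow> real" where
  "mzv ks = (\<Sum>\<^sub>\<infinity>ns\<in>mzv_indices (length ks). 1 / (\<Prod>i<length ks. real (ns ! i) ^ (ks ! i)))"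

definition H2 :: "nat \<Rightarrow> real" where
  "H2 n = mzv (replicate n 2)"

definition H232 :: "nat \<Rightarrow> nat \<Rightarrow> real" where
  "H232 a b = mzv (replicate a 2 @ [3] @ replicate b 2)"

definition zagier_coeff :: "nat \<Rightarrow> nat \<Rightarrow> nat \<Rightarrow> real" where
  "zagier_coeff a b k =
     real ((2 * k) choose (2 * a + 2)) - (1 - 1 / 2 ^ (2 * k)) * real ((2 * k) choose (2 * b + 1))"

lemma H2_0: "H2 0 = 1"
proof -
  have "mzv_indices 0 = {[]}"
    by (auto simp: mzv_indices_def)
  then show ?thesis
    by (simp add: H2_def mzv_def)
qed

end

theory Submission
  imports Defs "HOL-Computational_Algebra.Polynomial"
begin

text \<open>
  Splitting the sum at the index \<open>n\<close> that carries the exponent \<open>3\<close> gives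
  \<open>H(a,b) = \<Sum>\<^sub>n e\<^sub>a(n) E\<^sub>b(n) / n\<^sup>3\<close>, where \<open>e\<^sub>a(n)\<close> collects the indices below \<open>n\<close> and \<open>E\<^sub>b(n)\<close> those
  above. Put \<open>y\<^sub>n(u) = w\<^sub>n sin\<^bsup>2n\<^esup>(u/2)\<close> with \<open>w\<^sub>n = 4\<^sup>n / binom(2n, n)\<close>; then \<open>(y\<^sub>n / n\<^sup>2)'' = y\<^sub>n\<^sub>-\<^sub>1 - y\<^sub>n\<close>.
  Integrating twice yields \<open>u\<^bsup>2a+2\<^esup>/(2a+2)! = \<Sum>\<^sub>n e\<^sub>a(n) y\<^sub>n(u) / n\<^sup>2\<close>, and integrating by parts yields
  \<open>E\<^sub>b(n) = 1/\<pi> \<integral> y\<^sub>n(u) (\<pi>-u)\<^bsup>2b\<^esup>/(2b)! du\<close> over \<open>[0, \<pi>]\<close>. Together,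
  \<open>\<pi> H(a,b) = \<integral> p(u) cot(u/2) du\<close> for \<open>p(u) = u\<^bsup>2a+2\<^esup>/(2a+2)! (\<pi>-u)\<^bsup>2b+1\<^esup>/(2b+1)!\<close>. Expanding
  \<open>cot(u/2) = 2 \<Sum>\<^sub>k sin(ku)\<close> and integrating by parts, the even derivatives of \<open>p\<close> at \<open>0\<close> and \<open>\<pi>\<close> produce
  the two binomial coefficients and \<open>H(n) = \<pi>\<^bsup>2n\<^esup>/(2n+1)!\<close>.
\<close>

section \<open>Iterated tails of multiple zeta values\<close>

text \<open>The part of a multiple zeta sum whose indices all exceed \<open>n\<close>, as nested
  series with the smallest index outermost. In this form it can be matched with integrals through
  its differences in \<open>n\<close>.\<close>

fun mzv_tail :: "nat list \<Rightarrow> nat \<Rightarrow> real" where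
  "mzv_tail [] n = 1"
| "mzv_tail (k # ks) n = (\<Sum>m. mzv_tail ks (Suc (n + m)) / real (Suc (n + m)) ^ k)"

definition zeta2 :: real where
  "zeta2 = (\<Sum>m. 1 / real (Suc m) ^ 2)"

lemma zeta2_summable: "summable (\<lambda>m. 1 / real (Suc m) ^ 2)"
  using inverse_power_summable[of 2, where ?'a = real]
  by (subst summable_Suc_iff) (simp add: inverse_eq_divide)

lemma zeta2_nonneg: "0 \<le> zeta2"
  unfolding zeta2_def by (intro suminf_nonneg zeta2_summable) simp

lemma inverse_power_le_inverse_square:
  assumes "2 \<le> k"
  shows "1 / real (Suc m) ^ k \<le> 1 / real (Suc m) ^ 2"
  using assms by (intro divide_left_mono power_increasing) auto

text \<open>Every level is dominated by a constant multiple of the series of 1/m^2. Summability,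
  sign and bound are treated together because they pass jointly through the induction on the
  list.\<close>

lemma
  assumes k: "2 \<le> k" and ks: "\<And>m. 0 \<le> mzv_tail ks m" "\<And>m. mzv_tail ks m \<le> zeta2 ^ length ks"
  shows mzv_tail_Cons_summable: "summable (\<lambda>m. mzv_tail ks (Suc m) / real (Suc m) ^ k)" (is "summable ?f")
    and mzv_tail_Cons_nonneg: "0 \<le> mzv_tail (k # ks) n"
    and mzv_tail_Cons_le: "mzv_tail (k # ks) n \<le> zeta2 ^ length (k # ks)"
proof -
  let ?g = "\<lambda>m. zeta2 ^ length ks * (1 / real (Suc m) ^ 2)"
  have f0: "0 \<le> ?f m" for m
    using ks by simp
  have fg: "?f m \<le> ?g m" for m
    using mult_mono[OF ks(2)[of "Suc m"] inverse_power_le_inverse_square[OF k, of m]] zeta2_nonneg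
    by simp
  have sg: "summable ?g"
    by (intro summable_mult zeta2_summable)
  show sf: "summable ?f"
    by (rule summable_comparison_test'[OF sg, of 0]) (use f0 fg in \<open>simp only: real_norm_def abs_of_nonneg\<close>)
  have s: "summable (\<lambda>m. ?f (n + m))"
    using summable_ignore_initial_segment[OF sf, of n] by (simp add: add.commute)
  show "0 \<le> mzv_tail (k # ks) n"
    by (simp only: mzv_tail.simps) (rule suminf_nonneg[OF s], rule f0)
  have "suminf (\<lambda>m. ?f (n + m)) \<le> suminf ?f"
    using suminf_split_initial_segment[OF sf, of n] sum_nonneg[of "{..<n}" ?f, OF f0]
    by (simp add: add.commute)
  moreover have "suminf ?f \<le> suminf ?g"
    by (rule suminf_le[OF _ sf sg]) (rule fg)
  moreover have "suminf ?g = zeta2 ^ length (k # ks)"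
    by (subst suminf_mult[OF zeta2_summable]) (simp add: zeta2_def)
  ultimately show "mzv_tail (k # ks) n \<le> zeta2 ^ length (k # ks)"
    by (simp only: mzv_tail.simps)
qed

lemma mzv_tail_bounds:
  assumes "\<forall>k\<in>set ks. 2 \<le> k"
  shows "0 \<le> mzv_tail ks n \<and> mzv_tail ks n \<le> zeta2 ^ length ks"
  using assms
proof (induction ks arbitrary: n)
  case (Cons k ks)
  then show ?case
    using mzv_tail_Cons_nonneg[of k ks n] mzv_tail_Cons_le[of k ks n] by auto
qed simp

lemmas mzv_tail_nonneg = mzv_tail_bounds[THEN conjunct1]
lemmas mzv_tail_le = mzv_tail_bounds[THEN conjunct2]

lemma mzv_tail_summable:
  assumes "\<forall>k\<in>set (k # ks). 2 \<le> k"
  shows "summable (\<lambda>m. mzv_tail ks (Suc m) / real (Suc m) ^ k)"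
  using assms by (intro mzv_tail_Cons_summable mzv_tail_nonneg mzv_tail_le) auto

lemma mzv_tail_sums:
  assumes "\<forall>k\<in>set (k # ks). 2 \<le> k"
  shows "(\<lambda>m. mzv_tail ks (Suc (n + m)) / real (Suc (n + m)) ^ k) sums mzv_tail (k # ks) n"
  using summable_ignore_initial_segment[OF mzv_tail_summable[OF assms], of n]
  by (simp add: add.commute summable_sums)

lemma mzv_tail_Suc:
  assumes "\<forall>k\<in>set (k # ks). 2 \<le> k"
  shows "mzv_tail (k # ks) n - mzv_tail (k # ks) (Suc n) = mzv_tail ks (Suc n) / real (Suc n) ^ k"
  using suminf_split_head[OF sums_summable[OF mzv_tail_sums[OF assms, of n]]] by simp

lemma mzv_tail_tendsto_0:
  assumes "\<forall>k\<in>set (k # ks). 2 \<le> k"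
  shows "mzv_tail (k # ks) \<longlonglongrightarrow> 0"
proof -
  have "mzv_tail (k # ks) = (\<lambda>n. \<Sum>m. mzv_tail ks (Suc (m + n)) / real (Suc (m + n)) ^ k)"
    by (simp add: fun_eq_iff add.commute del: of_nat_Suc)
  with suminf_exist_split2[OF mzv_tail_summable[OF assms]] show ?thesis
    by simp
qed

text \<open>Unlike \<open>mzv_indices\<close>, this family is closed under removing the smallest
  index: what remains lies above that index.\<close>

definition mzv_indices_above :: "nat \<Rightarrow> nat \<Rightarrow> nat list set" where
  "mzv_indices_above n r = {ns. length ns = r \<and> sorted_wrt (<) ns \<and> (\<forall>m\<in>set ns. n < m)}"

lemma mzv_indices_above_Suc:
  "mzv_indices_above n (Suc r) = (\<lambda>(m, ns). m # ns) ` (SIGMA m:{n<..}. mzv_indices_above m r)"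
proof (intro set_eqI iffI)
  fix ns assume "ns \<in> mzv_indices_above n (Suc r)"
  then show "ns \<in> (\<lambda>(m, ns). m # ns) ` (SIGMA m:{n<..}. mzv_indices_above m r)"
    by (cases ns) (auto simp: mzv_indices_above_def image_iff)
qed (force simp: mzv_indices_above_def)

text \<open>All terms are nonnegative, so the unordered sum may be taken with the smallest index
  outside and the others, by induction, inside.\<close>

lemma has_sum_mzv_tail:
  assumes "\<forall>k\<in>set ks. 2 \<le> k"
  shows "((\<lambda>ns. 1 / (\<Prod>i<length ks. real (ns ! i) ^ (ks ! i))) has_sum mzv_tail ks n)
           (mzv_indices_above n (length ks))"
  using assms
proof (induction ks arbitrary: n)
  case Nil
  have "mzv_indices_above n 0 = {[]}"
    by (auto simp: mzv_indices_above_def)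
  then show ?case
    using has_sum_finite[of "{[]}" "\<lambda>_. 1::real"] by simp
next
  case (Cons k ks)
  let ?t = "\<lambda>ks ns. 1 / (\<Prod>i<length ks. real (ns ! i) ^ (ks ! i))"
  let ?f = "\<lambda>(m, ns). ?t ks ns / real m ^ k"
  let ?g = "\<lambda>m. mzv_tail ks m / real m ^ k"
  have inner: "((\<lambda>ns. ?f (m, ns)) has_sum ?g m) (mzv_indices_above m (length ks))" for m
    using has_sum_cmult_right[OF Cons.IH[of m], of "1 / real m ^ k"] Cons.prems by (simp add: mult.commute)
  have "((\<lambda>m. ?g (Suc (n + m))) has_sum mzv_tail (k # ks) n) UNIV"
    by (intro sums_nonneg_imp_has_sum mzv_tail_sums Cons.prems divide_nonneg_nonneg mzv_tail_nonneg)
       (use Cons.prems in auto)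
  also have "?this \<longleftrightarrow> (?g has_sum mzv_tail (k # ks) n) {n<..}"
    by (rule has_sum_reindex_bij_witness[of _ "\<lambda>m. m - Suc n" "\<lambda>m. Suc (n + m)"]) auto
  finally have outer: "(?g has_sum mzv_tail (k # ks) n) {n<..}" .
  have "?f summable_on (SIGMA m:{n<..}. mzv_indices_above m (length ks))"
    by (rule summable_on_SigmaI[OF inner]) (use outer in \<open>auto intro!: mult_nonneg_nonneg prod_nonneg simp: has_sum_iff\<close>)
  with inner outer
  have "(?f has_sum mzv_tail (k # ks) n) (SIGMA m:{n<..}. mzv_indices_above m (length ks))"
    by (intro has_sum_SigmaI)
  moreover have inj: "inj_on (\<lambda>(m, ns). m # ns) (SIGMA m:{n<..}. mzv_indices_above m (length ks))"
    by (auto simp: inj_on_def)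
  moreover have "?f = ?t (k # ks) \<circ> (\<lambda>(m, ns). m # ns)"
  proof
    fix x :: "nat \<times> nat list"
    show "?f x = (?t (k # ks) \<circ> (\<lambda>(m, ns). m # ns)) x"
      by (cases x, simp only: prod.lessThan_Suc_shift o_apply length_Cons split_conv) (simp add: mult.commute)
  qed
  ultimately have "(?t (k # ks) has_sum mzv_tail (k # ks) n)
      ((\<lambda>(m, ns). m # ns) ` (SIGMA m:{n<..}. mzv_indices_above m (length ks)))"
    by (simp only: has_sum_reindex[OF inj])
  then show ?case
    by (simp only: mzv_indices_above_Suc length_Cons)
qed

lemma mzv_eq_mzv_tail:
  assumes "\<forall>k\<in>set ks. 2 \<le> k"
  shows "mzv ks = mzv_tail ks 0"
proof -
  have "mzv_indices r = mzv_indices_above 0 r" for r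
    by (auto simp: mzv_indices_def mzv_indices_above_def Suc_le_eq)
  then show ?thesis
    using has_sum_mzv_tail[OF assms, of 0] by (simp add: mzv_def infsumI)
qed

text \<open>The elementary symmetric polynomial of degree \<open>a\<close> in the numbers \<open>1/m\<^sup>2\<close>, \<open>1 \<le> m \<le> n\<close>.\<close>

fun esym :: "nat \<Rightarrow> nat \<Rightarrow> real" where
  "esym 0 n = 1"
| "esym (Suc a) 0 = 0"
| "esym (Suc a) (Suc n) = esym (Suc a) n + esym a n / real (Suc n) ^ 2"

lemma esym_nonneg: "0 \<le> esym a n"
  by (induction a n rule: esym.induct) auto

lemma esym_le: "esym a n \<le> zeta2 ^ a"
proof (induction a arbitrary: n)
  case (Suc a)
  have "esym (Suc a) n = (\<Sum>m<n. esym a m / real (Suc m) ^ 2)"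
    by (induction n) (simp_all del: of_nat_Suc)
  also have "\<dots> \<le> (\<Sum>m<n. zeta2 ^ a * (1 / real (Suc m) ^ 2))"
    using divide_right_mono[OF Suc] by (intro sum_mono) simp
  also have "\<dots> = zeta2 ^ a * (\<Sum>m<n. 1 / real (Suc m) ^ 2)"
    by (simp only: sum_distrib_left)
  also have "\<dots> \<le> zeta2 ^ a * zeta2"
    unfolding zeta2_def[symmetric]
    by (intro mult_left_mono zero_le_power zeta2_nonneg, subst zeta2_def)
       (intro sum_le_suminf zeta2_summable, auto)
  finally show ?case by (simp add: mult.commute)
qed simp

lemma esym_mzv_tail_sums_shift:
  assumes k: "\<forall>k\<in>set (k # ks). 2 \<le> k"
    and sums: "(\<lambda>n. esym j n * mzv_tail (k # ks) (Suc n) / real (Suc n) ^ 2) sums s"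
  shows "(\<lambda>n. esym (Suc j) n * mzv_tail ks (Suc n) / real (Suc n) ^ k) sums s"
proof -
  \<comment> \<open>summation by parts, with a boundary term that vanishes in the limit\<close>
  have eq: "(\<Sum>n<N. esym j n * mzv_tail (k # ks) (Suc n) / real (Suc n) ^ 2) =
      esym (Suc j) N * mzv_tail (k # ks) N + (\<Sum>n<N. esym (Suc j) n * mzv_tail ks (Suc n) / real (Suc n) ^ k)"
    for N
  proof (induction N)
    case (Suc N)
    have "mzv_tail (k # ks) N = mzv_tail (k # ks) (Suc N) + mzv_tail ks (Suc N) / real (Suc N) ^ k"
      using mzv_tail_Suc[OF k, of N] by simp
    with Suc show ?case
      by (simp del: mzv_tail.simps of_nat_Suc add: algebra_simps)
  qed simp
  have "(\<lambda>N. esym (Suc j) N * mzv_tail (k # ks) N) \<longlonglongrightarrow> 0"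
  proof (rule Lim_null_comparison)
    show "(\<lambda>N. zeta2 ^ Suc j * mzv_tail (k # ks) N) \<longlonglongrightarrow> 0"
      using tendsto_mult_left[OF mzv_tail_tendsto_0[OF k]] by fastforce
    show "\<forall>\<^sub>F N in sequentially. norm (esym (Suc j) N * mzv_tail (k # ks) N) \<le> zeta2 ^ Suc j * mzv_tail (k # ks) N"
      using mzv_tail_nonneg[OF k] esym_le[of "Suc j"] esym_nonneg[of "Suc j"]
      by (auto simp del: mzv_tail.simps power_Suc simp: abs_mult intro!: always_eventually mult_right_mono)
  qed
  from tendsto_diff[OF sums[unfolded sums_def] this] show ?thesis
    by (simp add: sums_def eq del: mzv_tail.simps of_nat_Suc)
qed

text \<open>The split starts at the smallest index. Each use of
  \<open>esym_mzv_tail_sums_shift\<close> moves it one place to the right and absorbs the exponent 2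
  just passed into \<open>esym\<close>; after \<open>a\<close> moves it stands at
  \<open>k\<close>.\<close>

lemma mzv_tail_sums_esym:
  assumes k: "\<forall>k\<in>set (k # ks). 2 \<le> k"
  shows "(\<lambda>n. esym a n * mzv_tail ks (Suc n) / real (Suc n) ^ k) sums mzv (replicate a 2 @ k # ks)"
proof -
  \<comment> \<open>Head and rest vary with \<open>j\<close>, while the whole list and hence the
    value stay fixed.\<close>
  have "(\<lambda>n. esym j n * mzv_tail ks' (Suc n) / real (Suc n) ^ k') sums mzv (replicate a 2 @ k # ks)"
    if "replicate j 2 @ k' # ks' = replicate a 2 @ k # ks" "j \<le> a" for j k' ks'
    using that
  proof (induction j arbitrary: k' ks')
    case 0
    have "\<forall>k\<in>set (k' # ks'). 2 \<le> k"
      using k arg_cong[OF 0(1), of set] by auto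
    then show ?case
      using mzv_tail_sums[of k' ks' 0] mzv_eq_mzv_tail[of "k' # ks'"] 0 by simp
  next
    case (Suc j)
    have *: "replicate j 2 @ 2 # k' # ks' = replicate a 2 @ k # ks"
      using Suc.prems(1) by (simp add: replicate_app_Cons_same)
    have "\<forall>k\<in>set (k' # ks'). 2 \<le> k"
      using k arg_cong[OF *, of set] by auto
    then show ?case
      using esym_mzv_tail_sums_shift Suc.IH[OF *] Suc.prems by simp
  qed
  then show ?thesis by blast
qed

section \<open>Expansion of even powers\<close>

text \<open>This is \<open>4\<^sup>n / binom(2n, n)\<close>.\<close>

definition wallis :: "nat \<Rightarrow> real" where
  "wallis n = (\<Prod>i<n. real (2 * i + 2) / real (2 * i + 1))"

lemma wallis_0: "wallis 0 = 1"
  by (simp add: wallis_def)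

lemma wallis_Suc: "wallis (Suc n) * real (2 * n + 1) = wallis n * real (2 * n + 2)"
  by (simp add: wallis_def)

lemma wallis_pos: "0 < wallis n"
  unfolding wallis_def by (intro prod_pos) auto

lemma wallis_le: "wallis n \<le> real (2 * n + 1)"
proof (induction n)
  case (Suc n)
  have "wallis (Suc n) * real (2 * n + 1) \<le> real (2 * n + 1) * real (2 * n + 2)"
    unfolding wallis_Suc by (intro mult_right_mono Suc) simp
  then have "wallis (Suc n) \<le> real (2 * n + 2)"
    by (simp add: mult.commute)
  then show ?case by simp
qed (simp add: wallis_0)

definition sinpow :: "nat \<Rightarrow> real \<Rightarrow> real" where
  "sinpow n u = wallis n * sin (u / 2) ^ (2 * n)"

text \<open>\<open>sinpow_prim n\<close> and \<open>sinpow_prim2 n\<close> are the first and second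
  primitive of \<open>sinpow n - sinpow (Suc n)\<close> that vanish at 0. The index is shifted by
  one to avoid dividing by n = 0.\<close>

definition sinpow_prim :: "nat \<Rightarrow> real \<Rightarrow> real" where
  "sinpow_prim n u = wallis (Suc n) * sin (u / 2) ^ (2 * n + 1) * cos (u / 2) / real (Suc n)"

definition sinpow_prim2 :: "nat \<Rightarrow> real \<Rightarrow> real" where
  "sinpow_prim2 n u = sinpow (Suc n) u / real (Suc n) ^ 2"

lemma sinpow_nonneg: "0 \<le> sinpow n u"
  using wallis_pos[of n] by (simp add: sinpow_def)

lemma sinpow_prim2_nonneg: "0 \<le> sinpow_prim2 n u"
  by (simp add: sinpow_prim2_def sinpow_nonneg)

lemma sin_half_power_deriv:
  "((\<lambda>u. sin (u / 2) ^ Suc m) has_real_derivative real (Suc m) * sin (u / 2) ^ m * cos (u / 2) / 2)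
     (at u within S)"
proof -
  have "((\<lambda>u. sin (u / 2)) has_real_derivative cos (u / 2) / 2) (at u within S)"
    by (auto intro!: derivative_eq_intros)
  from DERIV_power_Suc[OF this, of m] show ?thesis
    by (simp add: mult_ac)
qed

lemma sinpow_prim2_deriv:
  "(sinpow_prim2 n has_real_derivative sinpow_prim n u) (at u within S)"
proof -
  have "((\<lambda>u. wallis (Suc n) / real (Suc n) ^ 2 * sin (u / 2) ^ Suc (2 * n + 1)) has_real_derivative
      wallis (Suc n) / real (Suc n) ^ 2 * (real (Suc (2 * n + 1)) * sin (u / 2) ^ (2 * n + 1) * cos (u / 2) / 2))
      (at u within S)"
    by (intro DERIV_cmult sin_half_power_deriv)
  also have "wallis (Suc n) / real (Suc n) ^ 2 * (real (Suc (2 * n + 1)) * sin (u / 2) ^ (2 * n + 1) * cos (u / 2) / 2)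
      = sinpow_prim n u"
    by (simp add: sinpow_prim_def power2_eq_square divide_simps)
  finally show ?thesis
    by (simp add: sinpow_prim2_def[abs_def] sinpow_def)
qed

text \<open>After cos^2 = 1 - sin^2 the recurrence \<open>wallis_Suc\<close> turns the coefficients
  of the two sine powers into exactly \<open>wallis n\<close> and \<open>wallis (Suc n)\<close>;
  this is what fixes the weights.\<close>

lemma sinpow_prim_deriv:
  "(sinpow_prim n has_real_derivative sinpow n u - sinpow (Suc n) u) (at u within S)"
proof -
  let ?s = "sin (u / 2)" and ?c = "cos (u / 2)"
  have c: "((\<lambda>u. cos (u / 2)) has_real_derivative - ?s / 2) (at u within S)"
    by (auto intro!: derivative_eq_intros)
  have "((\<lambda>u. wallis (Suc n) / real (Suc n) * (sin (u / 2) ^ Suc (2 * n) * cos (u / 2))) has_real_derivative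
      wallis (Suc n) / real (Suc n) *
        (real (Suc (2 * n)) * ?s ^ (2 * n) * ?c / 2 * ?c + - ?s / 2 * ?s ^ Suc (2 * n))) (at u within S)"
    by (intro DERIV_cmult DERIV_mult sin_half_power_deriv c)
  also have "(\<lambda>u. wallis (Suc n) / real (Suc n) * (sin (u / 2) ^ Suc (2 * n) * cos (u / 2))) = sinpow_prim n"
    by (simp add: fun_eq_iff sinpow_prim_def)
  also have "wallis (Suc n) / real (Suc n) *
        (real (Suc (2 * n)) * ?s ^ (2 * n) * ?c / 2 * ?c + - ?s / 2 * ?s ^ Suc (2 * n)) =
      sinpow n u - sinpow (Suc n) u"
  proof -
    have "real (Suc (2 * n)) * ?s ^ (2 * n) * ?c / 2 * ?c + - ?s / 2 * ?s ^ Suc (2 * n)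
        = ?s ^ (2 * n) / 2 * (real (2 * n + 1) * ?c\<^sup>2 - ?s\<^sup>2)"
      by (simp add: algebra_simps power2_eq_square)
    also have "\<dots> = ?s ^ (2 * n) / 2 * (real (2 * n + 1) - 2 * real (Suc n) * ?s\<^sup>2)"
      unfolding cos_squared_eq by (simp add: algebra_simps)
    finally have eq: "real (Suc (2 * n)) * ?s ^ (2 * n) * ?c / 2 * ?c + - ?s / 2 * ?s ^ Suc (2 * n) = \<dots>" .
    have *: "w / r * (t / 2 * (m - 2 * r * q)) = w * m * t / (2 * r) - w * (t * q)" if "r \<noteq> 0" for w r t m q :: real
      using that by (simp add: field_simps)
    have "wallis (Suc n) / real (Suc n) *
        (real (Suc (2 * n)) * ?s ^ (2 * n) * ?c / 2 * ?c + - ?s / 2 * ?s ^ Suc (2 * n))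
       = (wallis (Suc n) * real (2 * n + 1)) * ?s ^ (2 * n) / (2 * real (Suc n)) - wallis (Suc n) * (?s ^ (2 * n) * ?s\<^sup>2)"
      unfolding eq by (rule *) simp
    also have "wallis (Suc n) * real (2 * n + 1) = wallis n * (2 * real (Suc n))"
      unfolding wallis_Suc by simp
    finally show ?thesis
      by (simp add: sinpow_def power_add power2_eq_square mult_ac)
  qed
  finally show ?thesis .
qed

lemma continuous_on_sinpow [continuous_intros]: "continuous_on S (sinpow n)"
  unfolding sinpow_def by (intro continuous_intros) auto

text \<open>The geometric decay of the sine power beats the linear bound on \<open>wallis\<close>.
  At \<open>u = pi\<close> the value is \<open>wallis N\<close>, which is at least 1, so that end is
  excluded.\<close>

lemma sinpow_tendsto_0:
  assumes "0 \<le> u" "u < pi"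
  shows "(\<lambda>N. sinpow N u) \<longlonglongrightarrow> 0"
proof -
  define q where "q = sin (u / 2) ^ 2"
  have "cos (u / 2) > 0"
    using assms by (intro cos_gt_zero_pi) auto
  then have "cos (u / 2) ^ 2 > 0"
    by simp
  then have q: "0 \<le> q" "q < 1"
    unfolding q_def using sin_cos_squared_add[of "u / 2"] by (simp, linarith)
  have lim: "(\<lambda>N. 2 * (real N * q ^ N) + q ^ N) \<longlonglongrightarrow> 2 * 0 + 0"
    by (intro tendsto_intros powser_times_n_limit_0 LIMSEQ_realpow_zero) (use q in auto)
  show ?thesis
  proof (rule Lim_null_comparison)
    show "(\<lambda>N. 2 * (real N * q ^ N) + q ^ N) \<longlonglongrightarrow> 0"
      using lim by simp
    have "sinpow N u \<le> real (2 * N + 1) * q ^ N" for N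
      unfolding sinpow_def power_mult q_def by (intro mult_right_mono wallis_le) simp
    then show "\<forall>\<^sub>F N in sequentially. norm (sinpow N u) \<le> 2 * (real N * q ^ N) + q ^ N"
      by (simp add: sinpow_nonneg algebra_simps)
  qed
qed

section \<open>Convergence of the expansion of even powers\<close>

lemma second_order_bounds:
  fixes g g' g'' :: "real \<Rightarrow> real"
  assumes g: "\<And>x. (g has_real_derivative g' x) (at x)" and g': "\<And>x. (g' has_real_derivative g'' x) (at x)"
    and 0: "g 0 = 0" "g' 0 = 0"
    and mono: "mono_on {0..c} g''" and nonneg: "\<And>x. x \<in> {0..c} \<Longrightarrow> 0 \<le> g'' x"
  shows "mono_on {0..c} g" and "x \<in> {0..c} \<Longrightarrow> 0 \<le> g x \<and> g x \<le> x\<^sup>2 * g'' x"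
proof -
  \<comment> \<open>One integration: as \<open>f'\<close> is increasing, f(x) is at most x times the
    largest slope f'(x). This is applied first to \<open>g'\<close> and then to
    \<open>g\<close>.\<close>
  have step: "mono_on {0..c} f \<and> (\<forall>x\<in>{0..c}. 0 \<le> f x \<and> f x \<le> x * f' x)"
    if f: "\<And>x. (f has_real_derivative f' x) (at x)" and f0: "f 0 = 0"
      and mono: "mono_on {0..c} f'" and nonneg: "\<And>x. x \<in> {0..c} \<Longrightarrow> 0 \<le> f' x"
    for f f' :: "real \<Rightarrow> real"
  proof -
    have m: "mono_on {0..c} f"
    proof (rule mono_onI)
      fix r s assume "r \<in> {0..c}" "s \<in> {0..c}" "r \<le> s"
      then show "f r \<le> f s"
        using f nonneg by (intro DERIV_nonneg_imp_nondecreasing[of r s f]) (meson atLeastAtMost_iff order_trans)+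
    qed
    have "f x \<le> x * f' x" if x: "x \<in> {0..c}" for x
    proof -
      have "x * f' x - f x \<ge> 0 * f' x - f 0"
      proof (rule DERIV_nonneg_imp_nondecreasing[where f = "\<lambda>t. t * f' x - f t"])
        fix t assume t: "0 \<le> t" "t \<le> x"
        have "((\<lambda>t. t * f' x - f t) has_real_derivative f' x - f' t) (at t)"
          by (auto intro!: derivative_eq_intros f)
        moreover have "f' t \<le> f' x"
          using x t by (intro mono_onD[OF mono]) auto
        ultimately show "\<exists>y. ((\<lambda>t. t * f' x - f t) has_real_derivative y) (at t) \<and> 0 \<le> y"
          by (intro exI[of _ "f' x - f' t"]) simp
      qed (use x in auto)
      then show ?thesis by (simp add: f0)
    qed
    moreover have "0 \<le> f x" if "x \<in> {0..c}" for x
      using mono_onD[OF m, of 0 x] that f0 by auto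
    ultimately show ?thesis using m by blast
  qed
  have 1: "mono_on {0..c} g' \<and> (\<forall>x\<in>{0..c}. 0 \<le> g' x \<and> g' x \<le> x * g'' x)"
    by (rule step) (use assms in auto)
  then have 2: "mono_on {0..c} g \<and> (\<forall>x\<in>{0..c}. 0 \<le> g x \<and> g x \<le> x * g' x)"
    by (intro step) (use assms in auto)
  then show "mono_on {0..c} g" by simp
  assume x: "x \<in> {0..c}"
  then have "x * g' x \<le> x * (x * g'' x)"
    using 1 by (intro mult_left_mono) auto
  then show "0 \<le> g x \<and> g x \<le> x\<^sup>2 * g'' x"
    using 2 x by (fastforce simp: power2_eq_square mult.assoc)
qed

definition even_rem :: "nat \<Rightarrow> nat \<Rightarrow> real \<Rightarrow> real" where
  "even_rem a N u = u ^ (2 * a + 2) / fact (2 * a + 2) - (\<Sum>n<N. esym a n * sinpow_prim2 n u)"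

text \<open>Closed form of the second derivative of \<open>even_rem a N\<close>: differentiating
  twice lowers the order by one and leaves the boundary term of a summation by parts.\<close>

fun even_rem_deriv2 :: "nat \<Rightarrow> nat \<Rightarrow> real \<Rightarrow> real" where
  "even_rem_deriv2 0 N u = sinpow N u"
| "even_rem_deriv2 (Suc a) N u = even_rem a N u + esym (Suc a) N * sinpow N u"

text \<open>A step of \<open>esym a\<close> in \<open>n\<close> is
  \<open>esym (a - 1) n / (n + 1)^2\<close>, and the denominator turns \<open>sinpow (Suc n)\<close>
  into \<open>sinpow_prim2 n\<close>. For \<open>a = 0\<close> the sum telescopes from
  \<open>sinpow 0 u = 1\<close>.\<close>

lemma esym_sinpow_sum_by_parts:
  "(\<Sum>n<N. esym a n * (sinpow n u - sinpow (Suc n) u)) =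
     (if a = 0 then 1 else (\<Sum>n<N. esym (a - 1) n * sinpow_prim2 n u)) - esym a N * sinpow N u"
proof (cases a)
  case 0
  then show ?thesis
    by (induction N) (auto simp: sinpow_def wallis_0)
next
  case (Suc b)
  then show ?thesis
  proof (induction N)
    case (Suc N)
    then show ?case
      by (simp add: sinpow_prim2_def algebra_simps del: of_nat_Suc)
  qed simp
qed

lemma power_over_fact_deriv:
  "((\<lambda>u. u ^ Suc n / fact (Suc n)) has_real_derivative u ^ n / fact n) (at u within S)"
proof -
  have "((\<lambda>u. u ^ Suc n / fact (Suc n)) has_real_derivative real (Suc n) * u ^ n / fact (Suc n)) (at u within S)"
    using DERIV_cdivide[OF DERIV_power_Suc[OF DERIV_ident]] by (simp del: fact_Suc)
  then show ?thesis
    by (simp add: divide_simps del: of_nat_Suc)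
qed

lemma even_rem_deriv:
  defines "R' \<equiv> \<lambda>a N u. u ^ (2 * a + 1) / fact (2 * a + 1) - (\<Sum>n<N. esym a n * sinpow_prim n u)"
  shows "(even_rem a N has_real_derivative R' a N u) (at u)"
    and "(R' a N has_real_derivative even_rem_deriv2 a N u) (at u)"
    and "even_rem a N 0 = 0" and "R' a N 0 = 0"
proof -
  show "(even_rem a N has_real_derivative R' a N u) (at u)"
    unfolding even_rem_def R'_def
    by (intro DERIV_diff DERIV_sum DERIV_cmult sinpow_prim2_deriv)
       (use power_over_fact_deriv[of "2 * a + 1"] in simp)
  have "(R' a N has_real_derivative
      u ^ (2 * a) / fact (2 * a) - (\<Sum>n<N. esym a n * (sinpow n u - sinpow (Suc n) u))) (at u)"
    unfolding R'_def
    by (intro DERIV_diff DERIV_sum DERIV_cmult sinpow_prim_deriv)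
       (use power_over_fact_deriv[of "2 * a"] in simp)
  also have "u ^ (2 * a) / fact (2 * a) - (\<Sum>n<N. esym a n * (sinpow n u - sinpow (Suc n) u)) = even_rem_deriv2 a N u"
    unfolding esym_sinpow_sum_by_parts by (cases a) (simp_all add: even_rem_def)
  finally show "(R' a N has_real_derivative even_rem_deriv2 a N u) (at u)" .
qed (simp_all add: even_rem_def R'_def sinpow_prim2_def sinpow_def sinpow_prim_def)

lemma sinpow_mono: "mono_on {0..pi} (sinpow N)"
  unfolding sinpow_def
  by (intro mono_onI mult_left_mono power_mono sin_monotone_2pi_le sin_ge_zero less_imp_le[OF wallis_pos]) auto

text \<open>By \<open>second_order_bounds\<close> both properties pass from the second derivative to
  \<open>even_rem\<close> itself, and adding a nonnegative multiple of the increasing function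
  \<open>sinpow N\<close> preserves them.\<close>

lemma even_rem_deriv2_mono_nonneg:
  "mono_on {0..pi} (even_rem_deriv2 a N) \<and> (\<forall>x\<in>{0..pi}. 0 \<le> even_rem_deriv2 a N x)"
proof (induction a)
  case 0
  have "even_rem_deriv2 0 N = sinpow N"
    by (simp add: fun_eq_iff)
  then show ?case
    by (simp add: sinpow_mono sinpow_nonneg)
next
  case (Suc a)
  note b = second_order_bounds[OF even_rem_deriv, of pi a N]
  have "mono_on {0..pi} (even_rem a N)"
    using Suc by (intro b(1)) auto
  moreover have "0 \<le> even_rem a N x" if "x \<in> {0..pi}" for x
    using b(2)[OF _ _ that] Suc by auto
  moreover have "esym (Suc a) N * sinpow N x \<le> esym (Suc a) N * sinpow N y"
    if "x \<in> {0..pi}" "y \<in> {0..pi}" "x \<le> y" for x y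
    by (intro mult_left_mono mono_onD[OF sinpow_mono] that esym_nonneg)
  moreover have "0 \<le> esym (Suc a) N * sinpow N x" for x
    by (intro mult_nonneg_nonneg esym_nonneg sinpow_nonneg)
  ultimately show ?case
    unfolding even_rem_deriv2.simps mono_on_def by (simp add: add_mono)
qed

lemma even_rem_bounds:
  assumes "u \<in> {0..pi}"
  shows "0 \<le> even_rem a N u \<and> even_rem a N u \<le> u\<^sup>2 * even_rem_deriv2 a N u"
  using second_order_bounds(2)[OF even_rem_deriv, of pi a N u] even_rem_deriv2_mono_nonneg[of a N] assms
  by auto

text \<open>The remainder lies between 0 and \<open>u^2\<close> times its second derivative, which
  is made of the remainder of lower order and a bounded multiple of
  \<open>sinpow N u\<close>.\<close>

lemma even_rem_tendsto_0:
  assumes u: "0 \<le> u" "u < pi"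
  shows "(\<lambda>N. even_rem a N u) \<longlonglongrightarrow> 0"
proof -
  have step: "(\<lambda>N. even_rem a N u) \<longlonglongrightarrow> 0" if "(\<lambda>N. even_rem_deriv2 a N u) \<longlonglongrightarrow> 0" for a
  proof (rule Lim_null_comparison)
    show "(\<lambda>N. u\<^sup>2 * even_rem_deriv2 a N u) \<longlonglongrightarrow> 0"
      using tendsto_mult_left[OF that, of "u\<^sup>2"] by simp
    show "\<forall>\<^sub>F N in sequentially. norm (even_rem a N u) \<le> u\<^sup>2 * even_rem_deriv2 a N u"
      using even_rem_bounds[of u a] u by simp
  qed
  show ?thesis
  proof (induction a)
    case 0
    show ?case
      by (rule step) (simp add: sinpow_tendsto_0[OF u])
  next
    case (Suc a)
    have "(\<lambda>N. esym (Suc a) N * sinpow N u) \<longlonglongrightarrow> 0"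
    proof (rule Lim_null_comparison)
      show "(\<lambda>N. zeta2 ^ Suc a * sinpow N u) \<longlonglongrightarrow> 0"
        using tendsto_mult_left[OF sinpow_tendsto_0[OF u]] by fastforce
      show "\<forall>\<^sub>F N in sequentially. norm (esym (Suc a) N * sinpow N u) \<le> zeta2 ^ Suc a * sinpow N u"
        using esym_le[of "Suc a"] esym_nonneg[of "Suc a"] sinpow_nonneg[of _ u]
        by (auto simp: abs_mult simp del: power_Suc intro!: always_eventually mult_right_mono)
    qed
    from tendsto_add[OF Suc this] show ?case
      by (intro step) simp
  qed
qed

section \<open>Integral representations\<close>

lemma power_diff_over_fact_deriv:
  "((\<lambda>u. (c - u) ^ Suc n / fact (Suc n)) has_real_derivative - ((c - u) ^ n / fact n)) (at u within S)"
proof -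
  have "((\<lambda>u. c - u) has_real_derivative - 1) (at u within S)"
    by (auto intro!: derivative_eq_intros)
  from DERIV_chain2[OF power_over_fact_deriv this] show ?thesis
    by simp
qed

lemma has_integral_derivative:
  fixes f f' :: "real \<Rightarrow> real"
  assumes "a \<le> b" "\<And>u. (f has_real_derivative f' u) (at u within {a..b})" "f b - f a = c"
  shows "(f' has_integral c) {a..b}"
  using assms fundamental_theorem_of_calculus[of a b f f']
  by (simp add: has_real_derivative_iff_has_vector_derivative)

definition sinpow_moment :: "nat \<Rightarrow> nat \<Rightarrow> real" where
  "sinpow_moment n b = integral {0..pi} (\<lambda>u. sinpow n u * ((pi - u) ^ (2 * b) / fact (2 * b))) / pi"

lemma sinpow_moment_integrable:
  "(\<lambda>u. sinpow n u * ((pi - u) ^ m / fact m)) integrable_on {0..pi}"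
  by (intro integrable_continuous_interval continuous_intros) auto

text \<open>Consecutive integrals agree, since the integrands differ by the derivative of
  \<open>sinpow_prim\<close>, which vanishes at both ends. So every \<open>sinpow n\<close> has mean
  1.\<close>

lemma sinpow_moment_0: "sinpow_moment n 0 = 1"
proof (induction n)
  case 0
  then show ?case
    by (simp add: sinpow_moment_def sinpow_def wallis_0)
next
  case (Suc n)
  have "((\<lambda>u. sinpow n u - sinpow (Suc n) u) has_integral 0) {0..pi}"
    by (rule has_integral_derivative[OF _ sinpow_prim_deriv]) (simp_all add: sinpow_prim_def)
  moreover have "sinpow m integrable_on {0..pi}" for m
    using sinpow_moment_integrable[of m 0] by simp
  ultimately have "integral {0..pi} (sinpow n) = integral {0..pi} (sinpow (Suc n))"
    using integral_diff[of "sinpow n" "{0..pi}" "sinpow (Suc n)"] by (simp add: integral_unique)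
  with Suc show ?case
    by (simp add: sinpow_moment_def)
qed

text \<open>Two integrations by parts move the second derivative from \<open>sinpow_prim2\<close> to
  the power of \<open>pi - u\<close>. The tails with exponents 2 obey the same recurrence.\<close>

lemma sinpow_moment_Suc:
  "sinpow_moment n (Suc b) - sinpow_moment (Suc n) (Suc b) = sinpow_moment (Suc n) b / real (Suc n) ^ 2"
proof -
  define f where "f k u = (pi - u) ^ k / fact k" for k :: nat and u :: real
  have f: "(f (Suc k) has_real_derivative - f k u) (at u within S)" for k u S
    unfolding f_def by (rule power_diff_over_fact_deriv)
  have f_pi: "f (Suc k) pi = 0" for k
    by (simp add: f_def)
  \<comment> \<open>\<open>?G\<close> is a primitive of \<open>?g\<close> with zero boundary values:
    \<open>sinpow_prim\<close> and \<open>sinpow_prim2\<close> vanish at 0, the powers of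
    \<open>pi - u\<close> at \<open>pi\<close>.\<close>
  let ?G = "\<lambda>u. sinpow_prim n u * f (2 * b + 2) u + sinpow_prim2 n u * f (2 * b + 1) u"
  let ?g = "\<lambda>u. (sinpow n u * f (2 * b + 2) u - sinpow (Suc n) u * f (2 * b + 2) u) -
                 sinpow (Suc n) u * f (2 * b) u / real (Suc n) ^ 2"
  have int: "(\<lambda>u. sinpow n u * f m u) integrable_on {0..pi}" for n m
    unfolding f_def by (rule sinpow_moment_integrable)
  have I0: "(?g has_integral 0) {0..pi}"
  proof (rule has_integral_derivative[where f = ?G])
    fix u
    have "(?G has_real_derivative
        (sinpow n u - sinpow (Suc n) u) * f (2 * b + 2) u + - f (2 * b + 1) u * sinpow_prim n u +
        (sinpow_prim n u * f (2 * b + 1) u + - f (2 * b) u * sinpow_prim2 n u)) (at u within {0..pi})"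
      using f[of "2 * b + 1"] f[of "2 * b"]
      by (intro DERIV_add DERIV_mult sinpow_prim_deriv sinpow_prim2_deriv) simp_all
    then show "(?G has_real_derivative ?g u) (at u within {0..pi})"
      by (rule DERIV_cong) (simp add: sinpow_prim2_def algebra_simps del: of_nat_Suc)
  next
    show "?G pi - ?G 0 = 0"
      using f_pi[of "2 * b"] f_pi[of "2 * b + 1"]
      by (simp add: sinpow_prim_def sinpow_prim2_def sinpow_def)
  qed simp
  have I1: "(?g has_integral (integral {0..pi} (\<lambda>u. sinpow n u * f (2 * b + 2) u) -
      integral {0..pi} (\<lambda>u. sinpow (Suc n) u * f (2 * b + 2) u)) -
      integral {0..pi} (\<lambda>u. sinpow (Suc n) u * f (2 * b) u) / real (Suc n) ^ 2) {0..pi}"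
    by (intro has_integral_diff has_integral_divide integrable_integral int)
  have "(integral {0..pi} (\<lambda>u. sinpow n u * f (2 * b + 2) u) -
      integral {0..pi} (\<lambda>u. sinpow (Suc n) u * f (2 * b + 2) u)) =
      integral {0..pi} (\<lambda>u. sinpow (Suc n) u * f (2 * b) u) / real (Suc n) ^ 2"
    using has_integral_unique[OF I0 I1] by (simp del: of_nat_Suc)
  then show ?thesis
    unfolding sinpow_moment_def f_def by (simp add: diff_divide_distrib[symmetric] divide_simps del: of_nat_Suc fact_Suc)
qed

lemma sin_half_ge:
  assumes "0 \<le> u" "u \<le> pi"
  shows "u \<le> pi * sin (u / 2)"
proof -
  have "concave_on {0..pi} (\<lambda>u. sin (u / 2))"
    by (rule f''_le0_imp_concave[where f' = "\<lambda>u. cos (u / 2) / 2" and f'' = "\<lambda>u. - sin (u / 2) / 4"])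
       (auto intro!: derivative_eq_intros sin_ge_zero)
  from concave_onD_Icc'[OF this, of u] assms show ?thesis
    by (simp add: field_simps)
qed

lemma cos_half_ge:
  assumes "0 \<le> u" "u \<le> pi"
  shows "pi - u \<le> pi * cos (u / 2)"
proof -
  have "sin ((pi - u) / 2) = cos (u / 2)"
    by (simp add: cos_sin_eq diff_divide_distrib)
  then show ?thesis
    using sin_half_ge[of "pi - u"] assms by simp
qed

lemma sinpow_moment_nonneg: "0 \<le> sinpow_moment n b"
  unfolding sinpow_moment_def
  by (intro divide_nonneg_nonneg integral_nonneg sinpow_moment_integrable) (auto intro!: mult_nonneg_nonneg divide_nonneg_nonneg sinpow_nonneg)

text \<open>As (pi - u)^2 is at most pi^2 cos(u/2)^2, the moment is at most a constant times the
  mean of \<open>sinpow n u * cos (u / 2)^2\<close>, and by \<open>sinpow_moment_0\<close> this mean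
  is 1 - (2n+1)/(2n+2) = 1/(2n+2).\<close>

lemma sinpow_moment_tendsto_0: "(\<lambda>n. sinpow_moment n (Suc b)) \<longlonglongrightarrow> 0"
proof -
  define C where "C = pi ^ (2 * b + 2)"
  have le: "sinpow_moment n (Suc b) \<le> C / 2 * (1 / real (Suc n))" for n
  proof -
    have w: "wallis n = wallis (Suc n) * (real (2 * n + 1) / real (2 * n + 2))"
      using wallis_Suc[of n] by (simp add: field_simps)
    have "sinpow n u * ((pi - u) ^ (2 * b + 2) / fact (2 * b + 2)) \<le>
        C * (sinpow n u - real (2 * n + 1) / real (2 * n + 2) * sinpow (Suc n) u)" if u: "u \<in> {0..pi}" for u
    proof -
      have "(pi - u) ^ (2 * b + 2) / fact (2 * b + 2) \<le> (pi - u) ^ (2 * b + 2) / 1"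
        using u by (intro divide_left_mono) (auto simp: fact_ge_1 simp del: fact_Suc)
      also have "\<dots> = (pi - u) ^ (2 * b) * (pi - u)\<^sup>2"
        by (simp add: power_add power2_eq_square)
      also have "\<dots> \<le> pi ^ (2 * b) * (pi * cos (u / 2))\<^sup>2"
        using u cos_half_ge[of u] by (intro mult_mono power_mono) auto
      also have "\<dots> = C * (cos (u / 2))\<^sup>2"
        by (simp add: C_def power_add power_mult_distrib power2_eq_square)
      also have "\<dots> = C * (1 - (sin (u / 2))\<^sup>2)"
        by (simp add: cos_squared_eq)
      finally have "sinpow n u * ((pi - u) ^ (2 * b + 2) / fact (2 * b + 2)) \<le> sinpow n u * (C * (1 - (sin (u / 2))\<^sup>2))"
        by (intro mult_left_mono sinpow_nonneg)
      also have "sinpow n u * (sin (u / 2))\<^sup>2 = real (2 * n + 1) / real (2 * n + 2) * sinpow (Suc n) u"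
        by (simp add: sinpow_def w power2_eq_square)
      then have "sinpow n u * (C * (1 - (sin (u / 2))\<^sup>2)) = C * (sinpow n u - real (2 * n + 1) / real (2 * n + 2) * sinpow (Suc n) u)"
        by (simp add: algebra_simps)
      finally show ?thesis .
    qed
    moreover have "(sinpow m has_integral pi) {0..pi}" for m
      using sinpow_moment_0[of m] sinpow_moment_integrable[of m 0]
      by (simp add: sinpow_moment_def has_integral_iff)
    then have "((\<lambda>u. C * (sinpow n u - real (2 * n + 1) / real (2 * n + 2) * sinpow (Suc n) u)) has_integral
        C * (pi - real (2 * n + 1) / real (2 * n + 2) * pi)) {0..pi}"
      by (intro has_integral_mult_right has_integral_diff)
    ultimately have "integral {0..pi} (\<lambda>u. sinpow n u * ((pi - u) ^ (2 * b + 2) / fact (2 * b + 2))) \<le>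
        C * (pi - real (2 * n + 1) / real (2 * n + 2) * pi)"
      by (intro has_integral_le[OF integrable_integral[OF sinpow_moment_integrable]])
    also have "\<dots> = C / 2 * (1 / real (Suc n)) * pi"
      by (simp add: field_simps)
    finally show ?thesis
      by (simp add: sinpow_moment_def divide_le_eq mult_ac del: fact_Suc of_nat_Suc)
  qed
  show ?thesis
  proof (rule Lim_null_comparison)
    show "(\<lambda>n. C / 2 * (1 / real (Suc n))) \<longlonglongrightarrow> 0"
      using tendsto_mult_left[OF LIMSEQ_inverse_real_of_nat, of "C / 2"] by (simp add: inverse_eq_divide)
    show "\<forall>\<^sub>F n in sequentially. norm (sinpow_moment n (Suc b)) \<le> C / 2 * (1 / real (Suc n))"
      using le sinpow_moment_nonneg by (simp del: of_nat_Suc)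
  qed
qed

text \<open>The moments tend to 0, and their differences are, by induction on \<open>b\<close>, the
  terms of the series that defines the tail.\<close>

lemma mzv_tail_replicate_2: "mzv_tail (replicate b 2) n = sinpow_moment n b"
proof (induction b arbitrary: n)
  case (Suc b)
  have "(\<lambda>m. sinpow_moment (m + n) (Suc b)) \<longlonglongrightarrow> 0"
    by (rule LIMSEQ_ignore_initial_segment[OF sinpow_moment_tendsto_0])
  from telescope_sums'[OF this]
  have "(\<lambda>m. sinpow_moment (Suc (n + m)) b / real (Suc (n + m)) ^ 2) sums sinpow_moment n (Suc b)"
    by (simp add: sinpow_moment_Suc add.commute del: of_nat_Suc)
  then show ?case
    by (simp add: Suc sums_iff del: of_nat_Suc)
qed (simp add: sinpow_moment_0)

lemma H2_eq: "H2 n = pi ^ (2 * n) / fact (2 * n + 1)"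
proof -
  have "((\<lambda>u. (pi - u) ^ (2 * n) / fact (2 * n)) has_integral pi ^ (2 * n + 1) / fact (2 * n + 1)) {0..pi}"
  proof (rule has_integral_derivative)
    show "((\<lambda>u. - ((pi - u) ^ (2 * n + 1) / fact (2 * n + 1))) has_real_derivative (pi - u) ^ (2 * n) / fact (2 * n))
        (at u within {0..pi})" for u
      using DERIV_minus[OF power_diff_over_fact_deriv[of pi "2 * n"]] by simp
  qed auto
  from integral_unique[OF this] have "sinpow_moment 0 n = pi ^ (2 * n + 1) / fact (2 * n + 1) / pi"
    unfolding sinpow_moment_def sinpow_def by (simp only: wallis_0 mult_0_right power_0 mult_1)
  moreover have "H2 n = sinpow_moment 0 n"
    unfolding H2_def by (subst mzv_eq_mzv_tail) (auto simp: mzv_tail_replicate_2)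
  ultimately show ?thesis by simp
qed

text \<open>At \<open>u = 0\<close> the cotangent has the default value 0 of division by zero, so
  the weight is nonnegative on the closed interval despite the pole.\<close>

definition cot_weight :: "nat \<Rightarrow> real \<Rightarrow> real" where
  "cot_weight b u = (pi - u) ^ (2 * b + 1) / fact (2 * b + 1) * cot (u / 2)"

lemma cot_weight_nonneg: "u \<in> {0..pi} \<Longrightarrow> 0 \<le> cot_weight b u"
  unfolding cot_weight_def cot_def
  by (intro mult_nonneg_nonneg divide_nonneg_nonneg cos_ge_zero sin_ge_zero) auto

text \<open>The factor cot(u/2) turns \<open>sinpow_prim2 n\<close> into
  \<open>sinpow_prim n\<close> over n + 1, which raises the exponent from 2 to 3; one integration by
  parts then yields the moment.\<close>

lemma sinpow_moment_Suc_eq_cot_integral: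
  "((\<lambda>u. sinpow_prim2 n u * cot_weight b u) has_integral pi * sinpow_moment (Suc n) b / real (Suc n) ^ 3) {0..pi}"
proof -
  define f where "f k u = (pi - u) ^ k / fact k" for k :: nat and u :: real
  have f: "(f (Suc k) has_real_derivative - f k u) (at u within S)" for k u S
    unfolding f_def by (rule power_diff_over_fact_deriv)
  have pt: "sinpow_prim2 n u * cot_weight b u = sinpow_prim n u * f (2 * b + 1) u / real (Suc n)" for u
    by (cases "sin (u / 2) = 0")
       (simp_all add: sinpow_prim2_def sinpow_prim_def sinpow_def cot_weight_def cot_def f_def power2_eq_square mult_ac del: of_nat_Suc fact_Suc)
  let ?I = "integral {0..pi} (\<lambda>u. sinpow (Suc n) u * f (2 * b) u)"
  have I0: "((\<lambda>u. sinpow_prim n u * f (2 * b + 1) u - sinpow_prim2 n u * f (2 * b) u) has_integral 0) {0..pi}"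
  proof (rule has_integral_derivative[where f = "\<lambda>u. sinpow_prim2 n u * f (2 * b + 1) u"])
    fix u
    have "((\<lambda>u. sinpow_prim2 n u * f (2 * b + 1) u) has_real_derivative
        sinpow_prim n u * f (2 * b + 1) u + - f (2 * b) u * sinpow_prim2 n u) (at u within {0..pi})"
      using f[of "2 * b"] by (intro DERIV_mult sinpow_prim2_deriv) simp
    then show "((\<lambda>u. sinpow_prim2 n u * f (2 * b + 1) u) has_real_derivative
        sinpow_prim n u * f (2 * b + 1) u - sinpow_prim2 n u * f (2 * b) u) (at u within {0..pi})"
      by (simp add: mult.commute)
  qed (simp_all add: f_def sinpow_prim2_def sinpow_def)
  have I1: "((\<lambda>u. sinpow_prim2 n u * f (2 * b) u) has_integral ?I / real (Suc n) ^ 2) {0..pi}"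
    using has_integral_divide[OF integrable_integral[OF sinpow_moment_integrable[of "Suc n" "2 * b"]], of "real (Suc n) ^ 2"]
    by (simp add: sinpow_prim2_def f_def mult_ac del: of_nat_Suc)
  have "((\<lambda>u. sinpow_prim n u * f (2 * b + 1) u) has_integral ?I / real (Suc n) ^ 2) {0..pi}"
    using has_integral_add[OF I0 I1] by simp
  from has_integral_divide[OF this, of "real (Suc n)"] show ?thesis
    unfolding pt by (simp add: sinpow_moment_def f_def power3_eq_cube power2_eq_square mult_ac del: of_nat_Suc)
qed

lemma abs_mult_cot_half_le:
  assumes "u \<in> {0..pi}"
  shows "\<bar>u * cot (u / 2)\<bar> \<le> pi"
proof (cases "u = 0")
  case False
  with assms have s: "0 < sin (u / 2)"
    by (intro sin_gt_zero) auto
  have "\<bar>u * cos (u / 2)\<bar> \<le> pi * sin (u / 2) * 1"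
    unfolding abs_mult using sin_half_ge[of u] assms s by (intro mult_mono) auto
  with s show ?thesis
    by (simp add: cot_def abs_mult divide_simps)
qed simp

text \<open>The first power of \<open>u\<close> would not do: \<open>u * cot (u / 2)\<close> tends
  to 2 at 0 but has the default value 0 there. With the square the limit is 0 as well.\<close>

lemma continuous_on_square_cot_half: "continuous_on {0..pi} (\<lambda>u. u\<^sup>2 * cot (u / 2))"
proof -
  have "continuous (at u within {0..pi}) (\<lambda>u. u\<^sup>2 * cot (u / 2))" if u: "u \<in> {0..pi}" for u
  proof (cases "u = 0")
    case False
    then have "sin (u / 2) \<noteq> 0"
      using u sin_gt_zero[of "u / 2"] by auto
    then show ?thesis
      unfolding cot_def by (intro continuous_intros) auto
  next
    case True
    have "((\<lambda>u. u\<^sup>2 * cot (u / 2)) \<longlongrightarrow> 0) (at 0 within {0..pi})"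
    proof (rule Lim_null_comparison)
      show "((\<lambda>u. \<bar>u\<bar> * pi) \<longlongrightarrow> 0) (at 0 within {0..pi})"
        by (auto intro!: tendsto_eq_intros)
      have "norm (u\<^sup>2 * cot (u / 2)) \<le> \<bar>u\<bar> * pi" if "u \<in> {0..pi}" for u
        using mult_left_mono[OF abs_mult_cot_half_le[OF that], of "\<bar>u\<bar>"]
        by (simp add: power2_eq_square abs_mult mult.assoc)
      then show "\<forall>\<^sub>F u in at 0 within {0..pi}. norm (u\<^sup>2 * cot (u / 2)) \<le> \<bar>u\<bar> * pi"
        by (simp add: eventually_at_filter)
    qed
    with True show ?thesis
      by (simp add: continuous_within)
  qed
  then show ?thesis
    by (simp add: continuous_on_eq_continuous_within)
qed

text \<open>The expansion of the even power is integrated termwise against the weight. Its partial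
  sums are nonnegative and below the limit, so the limit itself is the dominating function.\<close>

lemma H232_integral:
  "((\<lambda>u. u ^ (2 * a + 2) / fact (2 * a + 2) * cot_weight b u) has_integral pi * H232 a b) {0..pi}"
proof -
  let ?h = "\<lambda>u. u ^ (2 * a + 2) / fact (2 * a + 2) * cot_weight b u"
  let ?s = "\<lambda>N u. (\<Sum>n<N. esym a n * sinpow_prim2 n u) * cot_weight b u"
  have s: "(?s N has_integral (\<Sum>n<N. esym a n * (pi * sinpow_moment (Suc n) b / real (Suc n) ^ 3))) {0..pi}" for N
    unfolding sum_distrib_right mult.assoc
    by (intro has_integral_sum has_integral_mult_right sinpow_moment_Suc_eq_cot_integral) auto
  have "continuous_on {0..pi} (\<lambda>u. u ^ (2 * a) / fact (2 * a + 2) * ((pi - u) ^ (2 * b + 1) / fact (2 * b + 1)) * (u\<^sup>2 * cot (u / 2)))"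
    by (intro continuous_on_mult continuous_on_square_cot_half) (intro continuous_intros; simp)+
  also have "(\<lambda>u. u ^ (2 * a) / fact (2 * a + 2) * ((pi - u) ^ (2 * b + 1) / fact (2 * b + 1)) * (u\<^sup>2 * cot (u / 2))) = ?h"
    by (simp add: fun_eq_iff cot_weight_def power2_eq_square del: fact_Suc)
  finally have h: "?h integrable_on {0..pi}"
    by (rule integrable_continuous_interval)
  have le: "norm (?s N u) \<le> ?h u" if "u \<in> {0..pi}" for N u
  proof -
    have "0 \<le> (\<Sum>n<N. esym a n * sinpow_prim2 n u)"
      by (intro sum_nonneg mult_nonneg_nonneg esym_nonneg sinpow_prim2_nonneg)
    moreover have "(\<Sum>n<N. esym a n * sinpow_prim2 n u) \<le> u ^ (2 * a + 2) / fact (2 * a + 2)"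
      using even_rem_bounds[OF that, of a N] by (simp add: even_rem_def)
    ultimately show ?thesis
      using cot_weight_nonneg[OF that, of b]
      by (simp only: real_norm_def abs_mult abs_of_nonneg mult_right_mono)
  qed
  have lim: "(\<lambda>N. ?s N u) \<longlonglongrightarrow> ?h u" if "u \<in> {0..pi}" for u
  proof (cases "u = pi")
    \<comment> \<open>The expansion is known to converge only below \<open>pi\<close>, but the
      weight vanishes at \<open>pi\<close>.\<close>
    case True
    then show ?thesis
      by (simp add: cot_weight_def)
  next
    case False
    with that have "(\<lambda>N. u ^ (2 * a + 2) / fact (2 * a + 2) - even_rem a N u) \<longlonglongrightarrow> u ^ (2 * a + 2) / fact (2 * a + 2) - 0"
      by (intro tendsto_diff tendsto_const even_rem_tendsto_0) auto
    then have "(\<lambda>N. \<Sum>n<N. esym a n * sinpow_prim2 n u) \<longlonglongrightarrow> u ^ (2 * a + 2) / fact (2 * a + 2)"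
      by (simp add: even_rem_def del: fact_Suc)
    then show ?thesis
      by (rule tendsto_mult_right)
  qed
  have lim_int: "(\<lambda>N. integral {0..pi} (?s N)) \<longlonglongrightarrow> integral {0..pi} ?h"
    by (rule dominated_convergence(2)[OF has_integral_integrable[OF s] h le lim])
  have eq: "integral {0..pi} (?s N) =
      pi * (\<Sum>n<N. esym a n * mzv_tail (replicate b 2) (Suc n) / real (Suc n) ^ 3)" for N
    unfolding integral_unique[OF s] mzv_tail_replicate_2 sum_distrib_left
    by (simp add: mult_ac del: of_nat_Suc)
  have "(\<lambda>N. pi * (\<Sum>n<N. esym a n * mzv_tail (replicate b 2) (Suc n) / real (Suc n) ^ 3)) \<longlonglongrightarrow> pi * H232 a b"
    using mzv_tail_sums_esym[of 3 "replicate b 2" a]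
    by (intro tendsto_mult_left) (simp add: sums_def H232_def del: of_nat_Suc)
  with lim_int have "integral {0..pi} ?h = pi * H232 a b"
    unfolding eq by (rule LIMSEQ_unique)
  with integrable_integral[OF h] show ?thesis
    by simp
qed

section \<open>Expansion of the cotangent\<close>

text \<open>Integration by parts against a uniformly small primitive \<open>F\<close> of the
  oscillating factor. \<open>q\<close> is differentiable only inside the interval, to allow for a
  cotangent singular at 0.\<close>

lemma oscillating_integral_bound:
  fixes q q' F f :: "real \<Rightarrow> real"
  assumes "a \<le> b" and q: "continuous_on {a..b} q"
    and q': "\<And>u. u \<in> {a<..<b} \<Longrightarrow> (q has_real_derivative q' u) (at u)"
    and B: "0 \<le> B" "\<And>u. u \<in> {a<..<b} \<Longrightarrow> \<bar>q' u\<bar> \<le> B"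
    and F: "\<And>u. (F has_real_derivative f u) (at u)" "\<And>u. \<bar>F u\<bar> \<le> e"
    and f: "continuous_on {a..b} f"
  shows "\<bar>integral {a..b} (\<lambda>u. q u * f u)\<bar> \<le> (\<bar>q a\<bar> + \<bar>q b\<bar> + B * (b - a)) * e"
proof -
  let ?I = "integral {a..b} (\<lambda>u. q u * f u)"
  have F_cont: "continuous_on {a..b} F"
    using F(1) by (intro DERIV_continuous_on) (auto intro: has_field_derivative_at_within)
  have "0 \<le> e"
    using F(2)[of 0] by simp
  have "((\<lambda>u. q' u * F u + f u * q u) has_integral q b * F b - q a * F a) {a..b}"
  proof (rule fundamental_theorem_of_calculus_interior)
    show "((\<lambda>u. q u * F u) has_vector_derivative q' u * F u + f u * q u) (at u)" if "u \<in> {a<..<b}" for u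
      using DERIV_mult[OF q'[OF that] F(1)]
      by (simp add: has_real_derivative_iff_has_vector_derivative)
  qed (use assms F_cont in \<open>auto intro!: continuous_on_mult\<close>)
  moreover have "((\<lambda>u. q u * f u) has_integral ?I) {a..b}"
    by (intro integrable_integral integrable_continuous_interval continuous_on_mult q f)
  ultimately have "((\<lambda>u. (q' u * F u + f u * q u) - q u * f u) has_integral q b * F b - q a * F a - ?I) {a..b}"
    by (rule has_integral_diff)
  then have "((\<lambda>u. q' u * F u) has_integral q b * F b - q a * F a - ?I) {a..b}"
    by (simp add: mult.commute)
  then have le: "norm (q b * F b - q a * F a - ?I) \<le> (B * e) * measure lborel (cbox a b)"
  proof (intro has_integral_bound_spike_finite[where S = "{a, b}"])
    show "norm (q' u * F u) \<le> B * e" if "u \<in> cbox a b - {a, b}" for u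
      using that B F(2) by (auto simp: abs_mult intro!: mult_mono)
  qed (use B \<open>0 \<le> e\<close> in auto)
  have "\<bar>q a * F a\<bar> \<le> \<bar>q a\<bar> * e" "\<bar>q b * F b\<bar> \<le> \<bar>q b\<bar> * e"
    unfolding abs_mult by (intro mult_left_mono F; simp)+
  with le have "\<bar>?I\<bar> \<le> \<bar>q a\<bar> * e + \<bar>q b\<bar> * e + B * e * (b - a)"
    using \<open>a \<le> b\<close> by simp
  then show ?thesis
    by (simp add: algebra_simps)
qed

lemma riemann_lebesgue:
  fixes q q' :: "real \<Rightarrow> real"
  assumes "a \<le> b" and q: "continuous_on {a..b} q"
    and q': "\<And>u. u \<in> {a<..<b} \<Longrightarrow> (q has_real_derivative q' u) (at u)"
    and B: "0 \<le> B" "\<And>u. u \<in> {a<..<b} \<Longrightarrow> \<bar>q' u\<bar> \<le> B"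
  shows "(\<lambda>N. integral {a..b} (\<lambda>u. q u * cos (real N * u))) \<longlonglongrightarrow> 0"
    and "(\<lambda>N. integral {a..b} (\<lambda>u. q u * sin (real N * u))) \<longlonglongrightarrow> 0"
proof -
  have lim: "I \<longlonglongrightarrow> 0" if I: "\<And>N. 0 < N \<Longrightarrow> \<bar>I N\<bar> \<le> M * (1 / real N)" for I :: "nat \<Rightarrow> real" and M
  proof (rule Lim_null_comparison)
    show "(\<lambda>N. M * (1 / real N)) \<longlonglongrightarrow> 0"
      using tendsto_mult_left[OF lim_const_over_n[of 1], of M] by simp
    show "\<forall>\<^sub>F N in sequentially. norm (I N) \<le> M * (1 / real N)"
      using eventually_gt_at_top[of 0] by eventually_elim (use I in simp)
  qed
  note bound = oscillating_integral_bound[OF assms]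
  show "(\<lambda>N. integral {a..b} (\<lambda>u. q u * cos (real N * u))) \<longlonglongrightarrow> 0"
  proof (rule lim[OF bound])
    fix N :: nat and u :: real
    assume N: "0 < N"
    show "((\<lambda>u. sin (real N * u) / real N) has_real_derivative cos (real N * u)) (at u)"
      using N by (auto intro!: derivative_eq_intros)
    show "\<bar>sin (real N * u) / real N\<bar> \<le> 1 / real N"
      using N by (simp add: abs_divide divide_right_mono)
  qed (auto intro!: continuous_intros)
  show "(\<lambda>N. integral {a..b} (\<lambda>u. q u * sin (real N * u))) \<longlonglongrightarrow> 0"
  proof (rule lim[OF bound])
    fix N :: nat and u :: real
    assume N: "0 < N"
    show "((\<lambda>u. - cos (real N * u) / real N) has_real_derivative sin (real N * u)) (at u)"
      using N by (auto intro!: derivative_eq_intros)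
    show "\<bar>- cos (real N * u) / real N\<bar> \<le> 1 / real N"
      using N by (simp add: abs_divide divide_right_mono)
  qed (auto intro!: continuous_intros)
qed

text \<open>The finite form of the divergent expansion of cot(u/2) into sines, obtained by summing
  \<open>cot (u / 2) * (cos (K u) - cos ((K + 1) u)) = sin ((K + 1) u) + sin (K u)\<close>.\<close>

lemma cot_half_cos_telescope:
  assumes "u \<in> {0..pi}"
  shows "cot (u / 2) * (1 - cos (real K * u)) = 2 * (\<Sum>k<K. sin (real (Suc k) * u)) - sin (real K * u)"
proof (cases "u = 0")
  case False
  with assms have s: "sin (u / 2) \<noteq> 0"
    using sin_gt_zero[of "u / 2"] by auto
  show ?thesis
  proof (induction K)
    case (Suc K)
    \<comment> \<open>The midpoint of the two angles: the addition formulas then produce a factor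
      \<open>sin (u / 2)\<close> that cancels the denominator of the cotangent.\<close>
    define A where "A = real K * u + u / 2"
    have A: "real K * u = A - u / 2" "real (Suc K) * u = A + u / 2"
      by (simp_all add: A_def algebra_simps)
    have "cot (u / 2) * (cos (real K * u) - cos (real (Suc K) * u)) = sin (real (Suc K) * u) + sin (real K * u)"
      unfolding A using s by (simp add: cot_def cos_diff cos_add sin_diff sin_add)
    with Suc show ?case
      by (simp add: algebra_simps del: of_nat_Suc)
  qed simp
qed simp

text \<open>The double zero of \<open>p\<close> at 0 makes \<open>p\<close> times the cotangent
  continuous, with bounded derivative inside the interval. Integrating the finite expansion leaves
  two error terms, both removed by \<open>riemann_lebesgue\<close>.\<close>

lemma cot_integral_sums:
  fixes r :: "real poly"
  defines "p \<equiv> monom 1 2 * r"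
  shows "(\<lambda>k. 2 * integral {0..pi} (\<lambda>u. poly p u * sin (real (Suc k) * u))) sums
           integral {0..pi} (\<lambda>u. poly p u * cot (u / 2))"
proof -
  have p: "poly p u = u\<^sup>2 * poly r u" for u
    by (simp add: p_def poly_monom)
  have ex: "\<exists>M\<ge>0. \<forall>u\<in>{0..pi}. \<bar>poly s u\<bar> \<le> M" for s :: "real poly"
  proof -
    have "continuous_on {0..pi} (poly s)"
      by (rule continuous_on_poly[OF continuous_on_id])
    from continuous_on_compact_bound[OF compact_Icc this]
    obtain M where "0 \<le> M" "\<And>u. u \<in> {0..pi} \<Longrightarrow> norm (poly s u) \<le> M"
      by blast
    then show ?thesis
      by (intro exI[of _ M]) simp
  qed
  obtain M0 M1 M2 where M: "0 \<le> M0" "0 \<le> M1" "0 \<le> M2"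
    "\<And>u. u \<in> {0..pi} \<Longrightarrow> \<bar>poly r u\<bar> \<le> M0" "\<And>u. u \<in> {0..pi} \<Longrightarrow> \<bar>poly (pderiv r) u\<bar> \<le> M1"
    "\<And>u. u \<in> {0..pi} \<Longrightarrow> \<bar>poly (pderiv p) u\<bar> \<le> M2"
    using ex[of r] ex[of "pderiv r"] ex[of "pderiv p"] by blast
  define q where "q u = u\<^sup>2 * cot (u / 2) * poly r u" for u
  \<comment> \<open>The derivative is arranged in terms of \<open>u * cot (u / 2)\<close> and
    \<open>u / sin (u / 2)\<close>, each at most \<open>pi\<close> in absolute value.\<close>
  define q' where "q' u = (2 * (u * cot (u / 2)) - (u / sin (u / 2))\<^sup>2 / 2) * poly r u +
      poly (pderiv r) u * (u * (u * cot (u / 2)))" for u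
  have q_cont: "continuous_on {0..pi} q"
    unfolding q_def by (intro continuous_on_mult continuous_on_square_cot_half continuous_intros)
  have p_cont: "continuous_on {0..pi} (poly p)"
    by (rule continuous_on_poly[OF continuous_on_id])
  have q'_deriv: "(q has_real_derivative q' u) (at u)" if u: "u \<in> {0<..<pi}" for u
  proof -
    have s: "sin (u / 2) \<noteq> 0"
      using u sin_gt_zero[of "u / 2"] by auto
    have "((\<lambda>u. cot (u / 2)) has_real_derivative - inverse ((sin (u / 2))\<^sup>2) * (1 / 2)) (at u)"
      by (rule DERIV_chain2[where f = cot and g = "\<lambda>u. u / 2"], rule DERIV_cot[OF s])
         (auto intro!: derivative_eq_intros)
    moreover have "((\<lambda>u::real. u\<^sup>2) has_real_derivative 2 * u) (at u)"
      by (auto intro!: derivative_eq_intros)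
    ultimately have "(q has_real_derivative
        (2 * u * cot (u / 2) + - inverse ((sin (u / 2))\<^sup>2) * (1 / 2) * u\<^sup>2) * poly r u +
        poly (pderiv r) u * (u\<^sup>2 * cot (u / 2))) (at u)"
      unfolding q_def by (intro DERIV_mult poly_DERIV)
    then show ?thesis
      by (rule DERIV_cong) (simp add: q'_def power2_eq_square field_simps)
  qed
  define B where "B = (2 * pi + pi\<^sup>2 / 2) * M0 + M1 * (pi * pi)"
  have "0 \<le> B"
    using M by (simp add: B_def)
  have q'_bound: "\<bar>q' u\<bar> \<le> B" if u: "u \<in> {0<..<pi}" for u
  proof -
    have u': "u \<in> {0..pi}"
      using u by simp
    have s: "0 < sin (u / 2)"
      using u by (intro sin_gt_zero) auto
    have "\<bar>u / sin (u / 2)\<bar> \<le> pi"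
      using s u sin_half_ge[of u] by (simp add: divide_le_eq)
    then have "(u / sin (u / 2))\<^sup>2 \<le> pi\<^sup>2"
      by (metis abs_ge_zero power2_abs power_mono)
    then have "\<bar>2 * (u * cot (u / 2)) - (u / sin (u / 2))\<^sup>2 / 2\<bar> \<le> 2 * pi + pi\<^sup>2 / 2"
      using abs_mult_cot_half_le[OF u'] zero_le_power2[of "u / sin (u / 2)"] by linarith
    then have "\<bar>(2 * (u * cot (u / 2)) - (u / sin (u / 2))\<^sup>2 / 2) * poly r u\<bar> \<le> (2 * pi + pi\<^sup>2 / 2) * M0"
      unfolding abs_mult using M(4)[OF u'] by (intro mult_mono) auto
    moreover have "\<bar>poly (pderiv r) u * (u * (u * cot (u / 2)))\<bar> \<le> M1 * (pi * pi)"
      unfolding abs_mult[of "poly _ _"] abs_mult[of u]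
      using M(2) M(5)[OF u'] abs_mult_cot_half_le[OF u'] u by (intro mult_mono) auto
    ultimately show ?thesis
      unfolding q'_def B_def by linarith
  qed
  have lim_q: "(\<lambda>K. integral {0..pi} (\<lambda>u. q u * cos (real K * u))) \<longlonglongrightarrow> 0"
    by (rule riemann_lebesgue(1)[OF pi_ge_zero q_cont q'_deriv \<open>0 \<le> B\<close> q'_bound])
  have lim_p: "(\<lambda>K. integral {0..pi} (\<lambda>u. poly p u * sin (real K * u))) \<longlonglongrightarrow> 0"
    by (rule riemann_lebesgue(2)[OF pi_ge_zero p_cont poly_DERIV M(3)]) (use M(6) in auto)
  have partial: "(\<Sum>k<K. 2 * integral {0..pi} (\<lambda>u. poly p u * sin (real (Suc k) * u))) =
      integral {0..pi} q - integral {0..pi} (\<lambda>u. q u * cos (real K * u)) +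
      integral {0..pi} (\<lambda>u. poly p u * sin (real K * u))" for K
  proof -
    have I: "(\<lambda>u. q u * cos (real K * u)) integrable_on {0..pi}" "q integrable_on {0..pi}"
      "(\<lambda>u. poly p u * sin (c * u)) integrable_on {0..pi}" for c
      by (intro integrable_continuous_interval continuous_intros q_cont p_cont)+
    have pt: "(\<Sum>k<K. 2 * (poly p u * sin (real (Suc k) * u))) =
        q u - q u * cos (real K * u) + poly p u * sin (real K * u)" if "u \<in> {0..pi}" for u
    proof -
      have "2 * (\<Sum>k<K. sin (real (Suc k) * u)) = cot (u / 2) * (1 - cos (real K * u)) + sin (real K * u)"
        using cot_half_cos_telescope[OF that, of K] by simp
      then have "poly p u * (2 * (\<Sum>k<K. sin (real (Suc k) * u))) =
          poly p u * (cot (u / 2) * (1 - cos (real K * u)) + sin (real K * u))"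
        by simp
      then show ?thesis
        by (simp add: sum_distrib_left q_def p algebra_simps)
    qed
    have "((\<lambda>u. q u - q u * cos (real K * u) + poly p u * sin (real K * u)) has_integral
        (\<Sum>k<K. 2 * integral {0..pi} (\<lambda>u. poly p u * sin (real (Suc k) * u)))) {0..pi}"
    proof (rule has_integral_eq)
      show "((\<lambda>u. \<Sum>k<K. 2 * (poly p u * sin (real (Suc k) * u))) has_integral
        (\<Sum>k<K. 2 * integral {0..pi} (\<lambda>u. poly p u * sin (real (Suc k) * u)))) {0..pi}"
        by (intro has_integral_sum has_integral_mult_right integrable_integral I) auto
    qed (rule pt)
    moreover have "((\<lambda>u. q u - q u * cos (real K * u) + poly p u * sin (real K * u)) has_integral
        integral {0..pi} q - integral {0..pi} (\<lambda>u. q u * cos (real K * u)) +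
        integral {0..pi} (\<lambda>u. poly p u * sin (real K * u))) {0..pi}"
      by (intro has_integral_add has_integral_diff integrable_integral I)
    ultimately show ?thesis
      by (rule has_integral_unique)
  qed
  have "(\<lambda>K. integral {0..pi} q - integral {0..pi} (\<lambda>u. q u * cos (real K * u)) +
      integral {0..pi} (\<lambda>u. poly p u * sin (real K * u))) \<longlonglongrightarrow> integral {0..pi} q - 0 + 0"
    by (intro tendsto_add tendsto_diff tendsto_const lim_q lim_p)
  moreover have "q = (\<lambda>u. poly p u * cot (u / 2))"
    by (simp add: fun_eq_iff q_def p)
  ultimately show ?thesis
    unfolding sums_def partial by simp
qed

text \<open>Each pair of integrations by parts splits off the boundary values of an even derivative
  and replaces \<open>p\<close> by its second derivative over \<open>-(k + 1)^2\<close>, until that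
  derivative is zero.\<close>

lemma poly_sin_integral:
  fixes p :: "real poly"
  assumes "(pderiv ^^ (2 * n)) p = 0"
  shows "((\<lambda>u. poly p u * sin (real (Suc k) * u)) has_integral
    (\<Sum>j<n. (-1) ^ j * (poly ((pderiv ^^ (2 * j)) p) 0 + (-1) ^ k * poly ((pderiv ^^ (2 * j)) p) pi) /
       real (Suc k) ^ (2 * j + 1))) {0..pi}"
  using assms
proof (induction n arbitrary: p)
  case (Suc n)
  define K where "K = real (Suc k)"
  have K: "K > 0"
    by (simp add: K_def)
  \<comment> \<open>The frequency is k + 1, so the cosine at \<open>pi\<close> is
    \<open>-((-1) ^ k)\<close>; hence the value at \<open>pi\<close> enters with the sign
    \<open>(-1) ^ k\<close>.\<close>
  have sin_pi: "sin (K * pi) = 0" and cos_pi: "cos (K * pi) = - ((-1) ^ k)"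
    using sin_npi[of "Suc k"] cos_npi[of "Suc k"] by (simp_all add: K_def del: of_nat_Suc)
  let ?p2 = "pderiv (pderiv p)"
  let ?S = "\<lambda>p n. (\<Sum>j<n. (-1) ^ j * (poly ((pderiv ^^ (2 * j)) p) 0 + (-1) ^ k * poly ((pderiv ^^ (2 * j)) p) pi) /
       K ^ (2 * j + 1))"
  have shift: "(pderiv ^^ (2 * Suc j)) p = (pderiv ^^ (2 * j)) ?p2" for j
    by (simp only: mult_Suc_right funpow_add add.commute[of 2]) (simp add: numeral_2_eq_2)
  have "((\<lambda>u. poly p u * sin (K * u) + poly ?p2 u * sin (K * u) / K\<^sup>2) has_integral
      (poly p 0 + (-1) ^ k * poly p pi) / K) {0..pi}"
  proof (rule has_integral_derivative[where f = "\<lambda>u. poly (pderiv p) u * (sin (K * u) / K\<^sup>2) - poly p u * (cos (K * u) / K)"])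
    fix u
    have s: "((\<lambda>u. sin (K * u) / K\<^sup>2) has_real_derivative cos (K * u) / K) (at u within {0..pi})"
      using K by (auto intro!: derivative_eq_intros simp: power2_eq_square)
    have c: "((\<lambda>u. cos (K * u) / K) has_real_derivative - sin (K * u)) (at u within {0..pi})"
      using K by (auto intro!: derivative_eq_intros)
    have p: "(poly q has_real_derivative poly (pderiv q) u) (at u within {0..pi})" for q
      by (rule has_field_derivative_at_within[OF poly_DERIV])
    show "((\<lambda>u. poly (pderiv p) u * (sin (K * u) / K\<^sup>2) - poly p u * (cos (K * u) / K)) has_real_derivative
        poly p u * sin (K * u) + poly ?p2 u * sin (K * u) / K\<^sup>2) (at u within {0..pi})"
      by (rule DERIV_cong[OF DERIV_diff[OF DERIV_mult[OF p s] DERIV_mult[OF p c]]]) (simp add: algebra_simps)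
  qed (use K in \<open>auto simp: sin_pi cos_pi field_simps\<close>)
  moreover have "((\<lambda>u. poly ?p2 u * sin (K * u)) has_integral ?S ?p2 n) {0..pi}"
    unfolding K_def using Suc.prems by (intro Suc.IH) (simp only: shift)
  then have "((\<lambda>u. poly ?p2 u * sin (K * u) / K\<^sup>2) has_integral ?S ?p2 n / K\<^sup>2) {0..pi}"
    by (rule has_integral_divide)
  ultimately have "((\<lambda>u. (poly p u * sin (K * u) + poly ?p2 u * sin (K * u) / K\<^sup>2) - poly ?p2 u * sin (K * u) / K\<^sup>2)
      has_integral (poly p 0 + (-1) ^ k * poly p pi) / K - ?S ?p2 n / K\<^sup>2) {0..pi}"
    by (rule has_integral_diff)
  also have "(poly p 0 + (-1) ^ k * poly p pi) / K - ?S ?p2 n / K\<^sup>2 = ?S p (Suc n)"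
    unfolding sum.lessThan_Suc_shift shift
    by (simp add: sum_divide_distrib sum_negf[symmetric] power2_eq_square mult_ac)
  finally show ?case
    by (simp add: K_def)
qed simp

section \<open>Odd zeta values and their alternating series\<close>

lemma mzv_odd_sums:
  assumes "1 \<le> j"
  shows "(\<lambda>k. 1 / real (Suc k) ^ (2 * j + 1)) sums mzv [2 * j + 1]"
  using mzv_tail_sums[of "2 * j + 1" "[]" 0] mzv_eq_mzv_tail[of "[2 * j + 1]"] assms
  by (simp del: of_nat_Suc)

text \<open>The plain series minus the alternating one is twice its part over even bases
  \<open>Suc k\<close>, which is the zeta series scaled by \<open>1 / 2 ^ (2 * j)\<close>.\<close>

lemma alternating_mzv_odd_sums:
  assumes "1 \<le> j"
  shows "(\<lambda>k. (-1) ^ k / real (Suc k) ^ (2 * j + 1)) sums ((1 - 1 / 2 ^ (2 * j)) * mzv [2 * j + 1])"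
proof -
  let ?Z = "mzv [2 * j + 1]"
  note Z = mzv_odd_sums[OF assms]
  let ?f = "\<lambda>k. (1 - (-1) ^ k) / real (Suc k) ^ (2 * j + 1) :: real"
  have "(\<lambda>m. 1 / 2 ^ (2 * j) * (1 / real (Suc m) ^ (2 * j + 1))) sums (1 / 2 ^ (2 * j) * ?Z)"
    by (intro sums_mult Z)
  also have "(\<lambda>m. 1 / 2 ^ (2 * j) * (1 / real (Suc m) ^ (2 * j + 1))) = (\<lambda>m. ?f (2 * m + 1))"
  proof
    fix m
    have "real (Suc (2 * m + 1)) = 2 * real (Suc m)"
      by simp
    then show "1 / 2 ^ (2 * j) * (1 / real (Suc m) ^ (2 * j + 1)) = ?f (2 * m + 1)"
      by (simp only: power_mult_distrib) (simp add: del: of_nat_Suc)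
  qed
  finally have "?f sums (1 / 2 ^ (2 * j) * ?Z)"
  proof (subst (asm) sums_mono_reindex)
    show "?f n = 0" if "n \<notin> range (\<lambda>m. 2 * m + 1)" for n
    proof -
      have "even n"
        using that by (metis oddE rangeI)
      then show ?thesis by simp
    qed
  qed (auto intro: strict_monoI)
  from sums_diff[OF Z this] show ?thesis
    by (simp add: diff_divide_distrib algebra_simps del: of_nat_Suc)
qed

section \<open>Derivatives of the polynomial at the two end points\<close>

lemma higher_pderiv_eq_0:
  fixes p :: "real poly"
  shows "degree p < m \<Longrightarrow> (pderiv ^^ m) p = 0"
  by (intro poly_eqI) (simp add: coeff_higher_pderiv coeff_eq_0)

lemma higher_pderiv_pcompose_reflect:
  fixes p :: "real poly"
  shows "(pderiv ^^ m) (pcompose p [:c, -1:]) = smult ((-1) ^ m) (pcompose ((pderiv ^^ m) p) [:c, -1:])"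
  by (induction m) (simp_all add: pderiv_smult pderiv_pcompose pderiv_pCons)

text \<open>General exponents let the reflection of \<open>u\<close> to \<open>pi - u\<close> act on
  the family by swapping \<open>m\<close> and \<open>n\<close>.\<close>

definition beta_poly :: "nat \<Rightarrow> nat \<Rightarrow> real poly" where
  "beta_poly m n = smult (1 / (fact m * fact n)) (monom 1 m * [:pi, -1:] ^ n)"

lemma poly_beta_poly: "poly (beta_poly m n) u = u ^ m / fact m * ((pi - u) ^ n / fact n)"
  by (simp add: beta_poly_def poly_monom)

lemma degree_beta_poly: "degree (beta_poly m n) \<le> m + n"
proof -
  have "degree (monom (1::real) m * [:pi, -1:] ^ n) \<le> degree (monom (1::real) m) + degree ([:pi, -1:] ^ n)"
    by (rule degree_mult_le)
  also have "\<dots> \<le> m + n"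
    using degree_power_le[of "[:pi, -1:]" n] by (intro add_mono degree_monom_le) simp
  finally show ?thesis
    by (simp add: beta_poly_def)
qed

lemma beta_poly_reflect: "pcompose (beta_poly m n) [:pi, -1:] = beta_poly n m"
  by (subst poly_eq_poly_eq_iff[symmetric]) (simp add: fun_eq_iff poly_pcompose poly_beta_poly mult.commute)

text \<open>The derivative is \<open>fact k\<close> times a coefficient, which the binomial
  expansion of \<open>(pi - u) ^ n\<close> provides; the factorials regroup into
  \<open>k choose m\<close>.\<close>

lemma higher_pderiv_beta_poly_0:
  assumes "k \<le> m + n"
  shows "poly ((pderiv ^^ k) (beta_poly m n)) 0 =
    (-1) ^ (k + m) * real (k choose m) * (pi ^ (m + n - k) / fact (m + n - k))"
proof (cases "m \<le> k")
  case True
  have "poly ((pderiv ^^ k) (beta_poly m n)) 0 = fact k * coeff (beta_poly m n) k"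
    by (simp add: poly_0_coeff_0 coeff_higher_pderiv pochhammer_fact)
  also have "coeff (beta_poly m n) k =
      1 / (fact m * fact n) * (real (n choose (k - m)) * (-1) ^ (k - m) * pi ^ (n - (k - m)))"
    using True assms by (simp add: beta_poly_def coeff_monom_mult coeff_linear_poly_power)
  also have "real (n choose (k - m)) = fact n / (fact (k - m) * fact (n - (k - m)))"
    using True assms by (intro binomial_fact) simp
  also have "(-1) ^ (k - m) = ((-1) ^ (k + m) :: real)"
    using True by (simp add: minus_one_power_iff)
  also have "n - (k - m) = m + n - k"
    using True by simp
  finally show ?thesis
    using binomial_fact[OF True, where 'a = real] by (simp add: mult_ac)
next
  case False
  then show ?thesis
    by (simp add: poly_0_coeff_0 coeff_higher_pderiv beta_poly_def coeff_monom_mult binomial_eq_0)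
qed

text \<open>The reflection exchanges the end points and the exponents at the cost of a sign
  \<open>(-1) ^ k\<close>.\<close>

lemma higher_pderiv_beta_poly_pi:
  assumes "k \<le> m + n"
  shows "poly ((pderiv ^^ k) (beta_poly m n)) pi =
    (-1) ^ n * real (k choose n) * (pi ^ (m + n - k) / fact (m + n - k))"
proof -
  have "poly ((pderiv ^^ k) (beta_poly n m)) 0 = (-1) ^ k * poly ((pderiv ^^ k) (beta_poly m n)) pi"
    unfolding beta_poly_reflect[of m n, symmetric] higher_pderiv_pcompose_reflect by (simp add: poly_pcompose)
  then have "poly ((pderiv ^^ k) (beta_poly m n)) pi = (-1) ^ k * poly ((pderiv ^^ k) (beta_poly n m)) 0"
    by (simp flip: mult.assoc power_mult_distrib)
  with higher_pderiv_beta_poly_0[of k n m] assms show ?thesis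
    by (simp add: add.commute power_add flip: mult.assoc power_mult_distrib)
qed

section \<open>Comparison of the two evaluations\<close>

theorem theorem1p1:
  fixes a b :: nat
  shows "H232 a b =
    2 * (\<Sum>k=1..a+b+1. (-1) ^ k * zagier_coeff a b k * mzv [2 * k + 1] * H2 (a + b + 1 - k))"
proof -
  define N where "N = a + b + 1"
  define p where "p = beta_poly (2 * a + 2) (2 * b + 1)"
  define A where "A j = poly ((pderiv ^^ (2 * j)) p) 0" for j
  define B where "B j = poly ((pderiv ^^ (2 * j)) p) pi" for j
  \<comment> \<open>The exponent is \<open>2 * (N - j) + 1\<close>, one more than in
    \<open>H2_eq\<close>; the surplus factor \<open>pi\<close> cancels at the end.\<close>
  have h: "pi ^ (2 * a + 2 + (2 * b + 1) - 2 * j) / fact (2 * a + 2 + (2 * b + 1) - 2 * j) = pi * H2 (N - j)"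
    if "j \<le> N" for j
  proof -
    have "2 * a + 2 + (2 * b + 1) - 2 * j = 2 * (N - j) + 1"
      using that by (simp add: N_def)
    then show ?thesis
      by (simp add: H2_eq)
  qed
  have A: "A j = real (2 * j choose (2 * a + 2)) * (pi * H2 (N - j))" if "j \<le> N" for j
    using higher_pderiv_beta_poly_0[of "2 * j" "2 * a + 2" "2 * b + 1"] that
    unfolding A_def p_def h[OF that] by (simp add: N_def)
  \<comment> \<open>The odd exponent \<open>2 * b + 1\<close> makes the sign negative, which is the
    source of the minus in \<open>zagier_coeff\<close>.\<close>
  have B: "B j = - (real (2 * j choose (2 * b + 1)) * (pi * H2 (N - j)))" if "j \<le> N" for j
    using higher_pderiv_beta_poly_pi[of "2 * j" "2 * a + 2" "2 * b + 1"] that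
    unfolding B_def p_def h[OF that] by (simp add: N_def)
  \<comment> \<open>The degree is at most \<open>2 * N + 1\<close>, so the boundary terms end with
    \<open>j = N\<close>.\<close>
  have zero: "(pderiv ^^ (2 * Suc N)) p = 0"
    using degree_beta_poly[of "2 * a + 2" "2 * b + 1"] by (intro higher_pderiv_eq_0) (simp add: p_def N_def)
  have sin_integral: "integral {0..pi} (\<lambda>u. poly p u * sin (real (Suc k) * u)) =
      (\<Sum>j=1..N. (-1) ^ j * (A j + (-1) ^ k * B j) / real (Suc k) ^ (2 * j + 1))" for k
  proof -
    have "integral {0..pi} (\<lambda>u. poly p u * sin (real (Suc k) * u)) =
      (\<Sum>j<Suc N. (-1) ^ j * (A j + (-1) ^ k * B j) / real (Suc k) ^ (2 * j + 1))"
      unfolding A_def B_def by (rule integral_unique[OF poly_sin_integral[OF zero]])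
    \<comment> \<open>\<open>p\<close> vanishes at both ends, so \<open>j = 0\<close> drops out; its
      exponent 1 would lead to the harmonic series.\<close>
    also have "\<dots> = (\<Sum>j=1..N. (-1) ^ j * (A j + (-1) ^ k * B j) / real (Suc k) ^ (2 * j + 1))"
    proof (rule sum.mono_neutral_right)
      have "{..<Suc N} - {1..N} = {0}"
        by auto
      then show "\<forall>j\<in>{..<Suc N} - {1..N}. (-1) ^ j * (A j + (-1) ^ k * B j) / real (Suc k) ^ (2 * j + 1) = 0"
        using A[of 0] B[of 0] by simp
    qed auto
    finally show ?thesis .
  qed
  \<comment> \<open>The series over \<open>k\<close> is summed in two ways: here for each
    \<open>j\<close> by zeta values, afterwards through the cotangent integral.\<close>
  have "(\<lambda>k. 2 * (\<Sum>j=1..N. (-1) ^ j * (A j + (-1) ^ k * B j) / real (Suc k) ^ (2 * j + 1))) sums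
      (2 * (\<Sum>j=1..N. (-1) ^ j * (A j * mzv [2 * j + 1] + B j * ((1 - 1 / 2 ^ (2 * j)) * mzv [2 * j + 1]))))"
  proof (intro sums_mult sums_sum)
    fix j assume "j \<in> {1..N}"
    then have j: "1 \<le> j"
      by simp
    have "(\<lambda>k. (-1) ^ j * (A j * (1 / real (Suc k) ^ (2 * j + 1)) + B j * ((-1) ^ k / real (Suc k) ^ (2 * j + 1)))) sums
        ((-1) ^ j * (A j * mzv [2 * j + 1] + B j * ((1 - 1 / 2 ^ (2 * j)) * mzv [2 * j + 1])))"
      by (intro sums_mult sums_add mzv_odd_sums alternating_mzv_odd_sums j)
    then show "(\<lambda>k. (-1) ^ j * (A j + (-1) ^ k * B j) / real (Suc k) ^ (2 * j + 1)) sums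
        ((-1) ^ j * (A j * mzv [2 * j + 1] + B j * ((1 - 1 / 2 ^ (2 * j)) * mzv [2 * j + 1])))"
      by (simp add: add_divide_distrib ring_distribs mult_ac del: of_nat_Suc)
  qed
  moreover have "(\<lambda>k. 2 * (\<Sum>j=1..N. (-1) ^ j * (A j + (-1) ^ k * B j) / real (Suc k) ^ (2 * j + 1))) sums (pi * H232 a b)"
  proof -
    \<comment> \<open>\<open>p\<close> with a factor \<open>u^2\<close> removed, as
      \<open>cot_integral_sums\<close> requires.\<close>
    define r where "r = smult (1 / (fact (2 * a + 2) * fact (2 * b + 1))) (monom 1 (2 * a) * [:pi, -1:] ^ (2 * b + 1))"
    have "monom (1::real) (2 * a + 2) = monom 1 2 * monom 1 (2 * a)"
      by (simp add: mult_monom)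
    then have p: "p = monom 1 2 * r"
      by (simp only: p_def r_def beta_poly_def mult_smult_right mult.assoc)
    have "integral {0..pi} (\<lambda>u. poly p u * cot (u / 2)) = pi * H232 a b"
      using integral_unique[OF H232_integral[of a b]]
      by (simp add: p_def poly_beta_poly cot_weight_def mult.assoc del: fact_Suc)
    then show ?thesis
      using cot_integral_sums[of r, folded p] unfolding sin_integral by simp
  qed
  ultimately have "pi * H232 a b =
      2 * (\<Sum>j=1..N. (-1) ^ j * (A j * mzv [2 * j + 1] + B j * ((1 - 1 / 2 ^ (2 * j)) * mzv [2 * j + 1])))"
    using sums_unique2 by blast
  also have "\<dots> = 2 * (\<Sum>j=1..N. pi * ((-1) ^ j * zagier_coeff a b j * mzv [2 * j + 1] * H2 (N - j)))"
    by (intro arg_cong[where f = "\<lambda>x. 2 * x"] sum.cong refl) (simp add: A B zagier_coeff_def algebra_simps)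
  also have "\<dots> = pi * (2 * (\<Sum>j=1..N. (-1) ^ j * zagier_coeff a b j * mzv [2 * j + 1] * H2 (N - j)))"
    by (simp add: sum_distrib_left mult_ac)
  finally show ?thesis
    by (simp add: N_def)
qed

end
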